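(* Let $\gamma\in\mathbb{C}^+\setminus\mathbb{R}_{>0}$. Then there exists $n_{\gamma}\in\mathbb{N}$ such that $\gamma\in\mathcal{R}(n)$ for all $n\geq n_{\gamma}$.
   Context: $\mathcal{K}^n$ denotes the set of all convex bodies (non-empty compact convex sets, possibly with empty interior) in $\mathbb{R}^n$; $\dim$ of a convex body is the dimension of its affine hull. For $K,E\in\mathcal{K}^n$ and $\lambda\geq 0$, the volume ($n$-dimensional Lebesgue measure) of the Minkowski sum $K+\lambda E$ is a polynomial in $\lambda$, written $\mathrm{vol}(K+\lambda E)=\sum_{i=0}^n\binom{n}{i}\mathrm{W}_i(K;E)\lambda^i$; the numbers $\mathrm{W}_i(K;E)$ are the relative quermassintegrals. The relative Steiner polynomial of $(K,E)$ is the polynomial $f_{K;E}(z)=\sum_{i=0}^n\binom{n}{i}\mathrm{W}_i(K;E)z^i$ in the complex variable $z$. Let $\mathbb{C}^+=\{z\in\mathbb{C}:\operatorname{Im}(z)\geq 0\}$ and let $\mathbb{R}_{>0}$ be the positive real axis. For $n\geq 2$, $\mathcal{R}(n)=\{z\in\mathbb{C}^+: f_{K;E}(z)=0\text{ for some }K,E\in\mathcal{K}^n\text{ with }\dim(K+E)=n\}$. *)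

theory Defs
  imports
    "HOL-Analysis.Analysis"
    "HOL-Library.Function_Algebras"
    "HOL-Library.Set_Algebras"
    "HOL-Computational_Algebra.Polynomial"
begin

text \<open>The dimension n has to vary inside a formula, so \<open>\<real>\<^sup>n\<close> is represented by the library's
  \<^const>\<open>Euclidean_space\<close>, the space of all \<open>x :: nat \<Rightarrow> real\<close> with \<open>x i = 0\<close> for \<open>i \<ge> n\<close>, carrying
  the product topology. With the pointwise vector space structure below, \<^const>\<open>convex\<close>,
  \<^const>\<open>hull\<close> and \<^const>\<open>dim\<close> apply to its subsets, and Minkowski sums are \<open>K + E\<close>.\<close>

instantiation "fun" :: (type, real_vector) real_vector
begin

definition scaleR_fun :: "real \<Rightarrow> ('a \<Rightarrow> 'b) \<Rightarrow> 'a \<Rightarrow> 'b"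
  where "scaleR_fun c f = (\<lambda>x. c *\<^sub>R f x)"

instance
  by standard (auto simp: scaleR_fun_def fun_eq_iff algebra_simps)

end

definition convex_body :: "nat \<Rightarrow> (nat \<Rightarrow> real) set \<Rightarrow> bool"
  where "convex_body n K \<longleftrightarrow> K \<noteq> {} \<and> convex K \<and> compactin (Euclidean_space n) K"

text \<open>\<^const>\<open>aff_dim\<close> requires a Euclidean space type; this is the linear dimension of the direction
  space of the affine hull. It is meant for non-empty sets.\<close>

definition affine_hull_dim :: "(nat \<Rightarrow> real) set \<Rightarrow> nat"
  where "affine_hull_dim K = dim {x - y | x y. x \<in> affine hull K \<and> y \<in> affine hull K}"

text \<open>The product measure lives on functions that are \<^const>\<open>undefined\<close> outside \<open>{..<n}\<close>; restriction
  identifies \<open>\<real>\<^sup>n\<close> with its space. It is Lebesgue measure on Borel sets, in particular on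
  compact ones.\<close>

definition vol :: "nat \<Rightarrow> (nat \<Rightarrow> real) set \<Rightarrow> real"
  where "vol n K = measure (PiM {..<n} (\<lambda>_. lborel)) ((\<lambda>x. restrict x {..<n}) ` K)"

definition is_relative_quermassintegrals ::
    "nat \<Rightarrow> (nat \<Rightarrow> real) set \<Rightarrow> (nat \<Rightarrow> real) set \<Rightarrow> (nat \<Rightarrow> real) \<Rightarrow> bool"
  where "is_relative_quermassintegrals n K E W \<longleftrightarrow>
    (\<forall>i>n. W i = 0) \<and>
    (\<forall>t\<ge>0. vol n (K + (\<lambda>x. t *\<^sub>R x) ` E) = (\<Sum>i\<le>n. real (n choose i) * W i * t ^ i))"

text \<open>For convex bodies, such a W exists by Minkowski's theorem on volumes of Minkowski sums.\<close>

definition relative_quermassintegral ::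
    "nat \<Rightarrow> (nat \<Rightarrow> real) set \<Rightarrow> (nat \<Rightarrow> real) set \<Rightarrow> nat \<Rightarrow> real"
  where "relative_quermassintegral n K E = (THE W. is_relative_quermassintegrals n K E W)"

lemma is_relative_quermassintegrals_unique:
  assumes "is_relative_quermassintegrals n K E V" and "is_relative_quermassintegrals n K E W"
  shows "V = W"
proof -
  define p where "p U = (\<Sum>i\<le>n. monom (real (n choose i) * U i) i)" for U :: "nat \<Rightarrow> real"
  have eval: "poly (p U) t = (\<Sum>i\<le>n. real (n choose i) * U i * t ^ i)" for U t
    by (simp add: p_def poly_sum poly_monom)
  have "{0..} \<subseteq> {t. poly (p V - p W) t = 0}"
    using assms by (auto simp: eval is_relative_quermassintegrals_def)
  then have "infinite {t. poly (p V - p W) t = 0}"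
    using infinite_Ici finite_subset by blast
  then have eq: "p V = p W"
    using poly_roots_finite[of "p V - p W"] by auto
  have coeff: "coeff (p U) i = real (n choose i) * U i" if "i \<le> n" for U i
    using that by (simp add: p_def coeff_sum)
  have "V i = W i" for i
  proof (cases "i \<le> n")
    case True
    then have "real (n choose i) * V i = real (n choose i) * W i"
      using eq coeff by metis
    moreover have "real (n choose i) \<noteq> 0"
      using True by simp
    ultimately show ?thesis
      by simp
  next
    case False
    then show ?thesis
      using assms by (simp add: is_relative_quermassintegrals_def)
  qed
  then show ?thesis
    by blast
qed

lemma relative_quermassintegral_eqI:
  "is_relative_quermassintegrals n K E W \<Longrightarrow> relative_quermassintegral n K E = W"
  unfolding relative_quermassintegral_def
  by (blast intro: the_equality is_relative_quermassintegrals_unique)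

definition steiner_poly :: "nat \<Rightarrow> (nat \<Rightarrow> real) set \<Rightarrow> (nat \<Rightarrow> real) set \<Rightarrow> complex poly"
  where "steiner_poly n K E =
    (\<Sum>i\<le>n. monom (of_nat (n choose i) * of_real (relative_quermassintegral n K E i)) i)"

definition steiner_roots :: "nat \<Rightarrow> complex set"
  where "steiner_roots n = {z. 0 \<le> Im z \<and>
    (\<exists>K E. convex_body n K \<and> convex_body n E \<and> affine_hull_dim (K + E) = n \<and>
       poly (steiner_poly n K E) z = 0)}"

end

theory Submission
  imports
    Defs
    "HOL-Computational_Algebra.Fundamental_Theorem_Algebra"
    "HOL-Real_Asymp.Real_Asymp"
begin

text \<open>If \<open>\<omega>\<close> is a root of the Steiner polynomial of \<open>(K, E)\<close> then \<open>a (\<omega> - \<mu>)\<close> is one for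
  \<open>(a (K + \<mu> E), E)\<close> whenever \<open>a > 0\<close> and \<open>\<mu> \<ge> 0\<close>, so a non-real \<open>\<gamma>\<close> is reached from any
  \<open>\<omega>\<close> in the open upper half plane with smaller argument; replacing \<open>K\<close> by \<open>K \<times> [0, 1]\<close> keeps
  the roots and raises the dimension. Starting from two copies of the cube \<open>[0, 1]\<^sup>k\<close> and taking
  \<open>k\<close> times the pyramid over \<open>K\<close>, one gets a multiple of the truncated binomial
  \<open>p z = (\<Sum>i\<le>k. (2k choose i) z\<^sup>i)\<close>. For large \<open>k\<close> it has roots of arbitrarily small argument:
  otherwise \<open>(ln p) / k\<close> would have a third derivative bounded near 1 uniformly in \<open>k\<close>, whereas it
  tends to \<open>2 ln (1 + x)\<close> for \<open>x \<le> 1\<close> and to \<open>ln (4 x)\<close> for \<open>x \<ge> 1\<close>, whose second derivatives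
  differ at 1. Real \<open>\<gamma> \<le> 0\<close> come from two cubes.\<close>

subsection \<open>Roots of truncated binomials\<close>

text \<open>The third difference of \<open>ln \<bar>x - z\<bar>\<close> at \<open>1 - \<delta>, 1, 1 + \<delta>, 1 + 2\<delta>\<close> is of order
  \<open>\<delta>\<^sup>3\<close>, stated without logarithms and with \<open>w = 1 - z\<close>.\<close>

lemma norm_cross_ratio_le:
  fixes w :: complex and \<delta> d :: real
  assumes \<delta>: "0 < \<delta>" "\<delta> \<le> 1" and d: "0 < d" "d \<le> 1" "d \<le> cmod w" "d \<le> cmod (w + of_real (2 * \<delta>))"
  shows "cmod (w + \<delta>) ^ 3 * cmod (w - \<delta>)
    \<le> cmod w ^ 3 * cmod (w + of_real (2 * \<delta>)) * (1 + 3 / d ^ 4 * \<delta> ^ 3)"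
proof -
  define u v where "u = cmod w" and "v = cmod (w + of_real (2 * \<delta>))"
  have uv: "d \<le> u" "d \<le> v" using d by (simp_all add: u_def v_def)
  have "cmod (w + \<delta>) ^ 3 * cmod (w - \<delta>) = cmod ((w + \<delta>) ^ 3 * (w - \<delta>))"
    by (simp add: norm_mult norm_power)
  \<comment> \<open>The two products agree in all terms of order 0, 1 and 2 in
    \<open>\<delta>\<close>, so only a cubic remainder is left.\<close>
  also have "(w + \<delta>) ^ 3 * (w - \<delta>)
    = w ^ 3 * (w + of_real (2 * \<delta>)) - of_real (\<delta> ^ 3) * (2 * w + \<delta>)"
    by (simp add: power2_eq_square power3_eq_cube algebra_simps)
  also have "cmod \<dots> \<le> cmod (w ^ 3 * (w + of_real (2 * \<delta>))) + cmod (of_real (\<delta> ^ 3) * (2 * w + \<delta>))"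
    by (rule norm_triangle_ineq4)
  also have "cmod (w ^ 3 * (w + of_real (2 * \<delta>))) = u ^ 3 * v"
    by (simp add: norm_mult norm_power u_def v_def)
  also have "cmod (of_real (\<delta> ^ 3) * (2 * w + \<delta>)) \<le> \<delta> ^ 3 * (2 * u + \<delta>)"
  proof -
    have "cmod (2 * w + \<delta>) \<le> 2 * u + \<delta>"
      using norm_triangle_ineq[of "2 * w" "of_real \<delta>"] \<delta> by (simp add: norm_mult u_def)
    then show ?thesis
      using \<delta> by (simp add: norm_mult norm_power mult_left_mono)
  qed
  \<comment> \<open>Each of \<open>u\<close>, \<open>u\<close> and \<open>\<delta>\<close> is at
    most \<open>u ^ 3 * v / d ^ 4\<close>, because \<open>d\<close> bounds \<open>u\<close> and
    \<open>v\<close> from below and \<open>d\<close>, \<open>\<delta>\<close> are at most 1. This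
    gives the constant 3.\<close>
  also have "2 * u + \<delta> \<le> u ^ 3 * v * (3 / d ^ 4)"
  proof -
    have "u * d ^ 4 \<le> u ^ 3 * v"
    proof -
      have "d ^ 4 = d ^ 2 * (d * d)" by (simp add: power4_eq_xxxx power2_eq_square)
      also have "\<dots> \<le> u ^ 2 * (v * 1)"
        using uv d by (intro mult_mono power_mono) auto
      finally have "u * d ^ 4 \<le> u * (u ^ 2 * (v * 1))"
        using uv d by (intro mult_left_mono) auto
      then show ?thesis by (simp add: power2_eq_square power3_eq_cube mult.assoc)
    qed
    moreover have "\<delta> * d ^ 4 \<le> u ^ 3 * v"
    proof -
      have "\<delta> * d ^ 4 \<le> 1 * d ^ 4" using \<delta> by (intro mult_right_mono) auto
      also have "\<dots> = d ^ 3 * d" by (simp add: power4_eq_xxxx power3_eq_cube)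
      also have "\<dots> \<le> u ^ 3 * v" using uv d by (intro mult_mono power_mono) auto
      finally show ?thesis .
    qed
    ultimately have "(2 * u + \<delta>) * d ^ 4 \<le> u ^ 3 * v * 3" by (simp add: algebra_simps)
    then show ?thesis using d by (simp add: pos_le_divide_eq)
  qed
  then have "u ^ 3 * v + \<delta> ^ 3 * (2 * u + \<delta>) \<le> u ^ 3 * v * (1 + 3 / d ^ 4 * \<delta> ^ 3)"
    using mult_left_mono[of "2 * u + \<delta>" "u ^ 3 * v * (3 / d ^ 4)" "\<delta> ^ 3"] \<delta>
    by (simp add: algebra_simps)
  finally show ?thesis unfolding u_def v_def using \<delta> by (simp add: mult_left_mono)
qed

text \<open>Multiply the bound for a single factor over all roots, with
  \<open>w = 1 - root i\<close>. Both sides contain the leading coefficient to the fourth power, so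
  only the error factor, once per root, remains.\<close>

lemma poly_cross_ratio_le:
  fixes p :: "complex poly" and \<delta> d :: real
  assumes \<delta>: "0 < \<delta>" "\<delta> \<le> 1" and d: "0 < d" "d \<le> 1"
    and roots: "\<And>z. poly p z = 0 \<Longrightarrow> d \<le> cmod (1 - z) \<and> d \<le> cmod (of_real (1 + 2 * \<delta>) - z)"
  shows "cmod (poly p (of_real (1 + \<delta>))) ^ 3 * cmod (poly p (of_real (1 - \<delta>)))
    \<le> cmod (poly p 1) ^ 3 * cmod (poly p (of_real (1 + 2 * \<delta>))) * (1 + 3 / d ^ 4 * \<delta> ^ 3) ^ degree p"
proof (cases "p = 0")
  case False
  obtain root where root: "smult (lead_coeff p) (\<Prod>i<degree p. [:- root i, 1:]) = p"
    by (rule complex_poly_decompose')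
  define l where "l = cmod (lead_coeff p)"
  have eval: "cmod (poly p x) = l * (\<Prod>i<degree p. cmod (x - root i))" for x
  proof -
    have "poly p x = lead_coeff p * (\<Prod>i<degree p. x - root i)"
      by (subst root [symmetric]) (simp add: poly_prod)
    then show ?thesis by (simp add: norm_mult prod_norm l_def)
  qed
  have zero: "poly p (root i) = 0" if "i < degree p" for i
    by (subst root [symmetric]) (use that in \<open>auto simp: poly_prod\<close>)
  have "(\<Prod>i<degree p. cmod (of_real (1 + \<delta>) - root i) ^ 3 * cmod (of_real (1 - \<delta>) - root i))
    \<le> (\<Prod>i<degree p. cmod (1 - root i) ^ 3 * cmod (of_real (1 + 2 * \<delta>) - root i)
        * (1 + 3 / d ^ 4 * \<delta> ^ 3))"
  proof (rule prod_mono, intro conjI)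
    fix i assume "i \<in> {..<degree p}"
    then have "d \<le> cmod (1 - root i)" "d \<le> cmod (of_real (1 + 2 * \<delta>) - root i)"
      using roots zero by auto
    then show "cmod (of_real (1 + \<delta>) - root i) ^ 3 * cmod (of_real (1 - \<delta>) - root i)
      \<le> cmod (1 - root i) ^ 3 * cmod (of_real (1 + 2 * \<delta>) - root i) * (1 + 3 / d ^ 4 * \<delta> ^ 3)"
      using norm_cross_ratio_le[OF \<delta> d, of "1 - root i"] by (simp add: algebra_simps)
  qed simp
  then have "l ^ 4 * ((\<Prod>i<degree p. cmod (of_real (1 + \<delta>) - root i)) ^ 3
        * (\<Prod>i<degree p. cmod (of_real (1 - \<delta>) - root i)))
    \<le> l ^ 4 * ((\<Prod>i<degree p. cmod (1 - root i)) ^ 3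
        * (\<Prod>i<degree p. cmod (of_real (1 + 2 * \<delta>) - root i)) * (1 + 3 / d ^ 4 * \<delta> ^ 3) ^ degree p)"
    unfolding prod.distrib prod_power_distrib [symmetric] prod_constant card_lessThan
    by (intro mult_left_mono) (auto simp: l_def)
  moreover have "l ^ 4 * (a ^ 3 * b) = (l * a) ^ 3 * (l * b)" for a b
    by (simp add: power4_eq_xxxx power3_eq_cube)
  moreover have "l ^ 4 * (a ^ 3 * b * c) = (l * a) ^ 3 * (l * b) * c" for a b c
    by (simp add: power4_eq_xxxx power3_eq_cube)
  ultimately show ?thesis
    unfolding eval by (simp only:)
qed simp

section \<open>Growth of the truncated binomial on the positive axis\<close>

text \<open>The lower half of the expansion of \<open>(1 + x) ^ (2 * k)\<close>, middle term
  included. It is polymorphic because the size estimates are real and the roots complex.\<close>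

definition half_binomial :: "nat \<Rightarrow> 'a::comm_ring_1 \<Rightarrow> 'a"
  where "half_binomial k x = (\<Sum>i\<le>k. of_nat (2 * k choose i) * x ^ i)"

text \<open>Each power is at most \<open>x ^ k\<close>, and the whole row of coefficients sums to
  \<open>4 ^ k\<close>.\<close>

lemma half_binomial_le:
  fixes x :: real
  assumes "1 \<le> x"
  shows "half_binomial k x \<le> 4 ^ k * x ^ k"
proof -
  have "half_binomial k x \<le> (\<Sum>i\<le>k. real (2 * k choose i) * x ^ k)"
    unfolding half_binomial_def using assms
    by (intro sum_mono mult_left_mono power_increasing) auto
  also have "\<dots> \<le> (\<Sum>i\<le>2 * k. real (2 * k choose i)) * x ^ k"
    unfolding sum_distrib_right [symmetric] using assms
    by (intro mult_right_mono sum_mono2) auto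
  also have "(\<Sum>i\<le>2 * k. real (2 * k choose i)) = 4 ^ k"
    using choose_row_sum[of "2 * k"] by (simp add: power_mult flip: of_nat_sum)
  finally show ?thesis .
qed

text \<open>The middle term alone suffices, by the lower bound for the central binomial coefficient.
  The loss is polynomial in \<open>k\<close>, hence harmless against exponential growth.\<close>

lemma half_binomial_ge_last:
  fixes x :: real
  assumes "0 \<le> x" "0 < k"
  shows "4 ^ k * x ^ k / (2 * real k) \<le> half_binomial k x"
proof -
  have "4 ^ k * x ^ k / (2 * real k) = 4 ^ k / (2 * real k) * x ^ k" by simp
  also have "\<dots> \<le> real (2 * k choose k) * x ^ k"
    using central_binomial_lower_bound[OF assms(2)] assms by (intro mult_right_mono) auto
  also have "\<dots> \<le> half_binomial k x"
    unfolding half_binomial_def using assms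
    by (intro member_le_sum[where f = "\<lambda>i. real (2 * k choose i) * x ^ i"]) auto
  finally show ?thesis .
qed

text \<open>The terms \<open>i\<close> and \<open>2k - i\<close> have the same binomial coefficient.\<close>

lemma half_binomial_ge_half:
  fixes x :: real
  assumes "0 \<le> x" "x \<le> 1"
  shows "(1 + x) ^ (2 * k) / 2 \<le> half_binomial k x"
proof -
  let ?f = "\<lambda>i. real (2 * k choose i) * x ^ i"
  have "(1 + x) ^ (2 * k) = (\<Sum>i\<le>2 * k. ?f i)"
    using binomial_ring[of x 1 "2 * k"] by (simp add: add.commute)
  also have "\<dots> = (\<Sum>i\<le>k. ?f i) + (\<Sum>i\<in>{k<..2 * k}. ?f i)"
    by (subst sum.union_disjoint [symmetric]) (auto intro!: sum.cong)
  also have "(\<Sum>i\<in>{k<..2 * k}. ?f i) = (\<Sum>j<k. ?f (2 * k - j))"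
    by (rule sum.reindex_bij_witness[where i = "\<lambda>j. 2 * k - j" and j = "\<lambda>j. 2 * k - j"]) auto
  also have "\<dots> \<le> (\<Sum>j<k. ?f j)"
  proof (rule sum_mono)
    fix j assume "j \<in> {..<k}"
    then show "?f (2 * k - j) \<le> ?f j"
      using assms binomial_symmetric[of j "2 * k"] by (auto intro!: mult_left_mono power_decreasing)
  qed
  also have "\<dots> \<le> (\<Sum>j\<le>k. ?f j)"
    using assms by (intro sum_mono2) auto
  finally show ?thesis by (simp add: half_binomial_def)
qed

lemma cnj_half_binomial: "cnj (half_binomial k z) = half_binomial k (cnj z)"
  by (simp add: half_binomial_def)

lemma half_binomial_of_real:
  "half_binomial k (complex_of_real x) = complex_of_real (half_binomial k x)"
  by (simp add: half_binomial_def)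

lemma half_binomial_pos:
  fixes x :: real
  assumes "0 \<le> x"
  shows "0 < half_binomial k x"
proof -
  have "0 < real (2 * k choose 0) * x ^ 0" by simp
  also have "\<dots> \<le> half_binomial k x"
    unfolding half_binomial_def using assms
    by (intro member_le_sum[where f = "\<lambda>i. real (2 * k choose i) * x ^ i"]) auto
  finally show ?thesis .
qed

section \<open>Roots close to the positive axis\<close>

text \<open>Bound the left side of \<open>cross\<close> from below by the middle term at
  \<open>1 + \<delta>\<close> and by half of the full expansion at \<open>1 - \<delta>\<close>, and
  the right side from above. The losses \<open>2 * real k\<close>, three times, and 2 multiply to
  \<open>16 * real k ^ 3\<close>.\<close>

lemma half_binomial_third_difference:
  fixes \<delta> C :: real
  assumes "0 < \<delta>" "\<delta> \<le> 1" "0 < C" "0 < k"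
    and cross: "half_binomial k (1 + \<delta>) ^ 3 * half_binomial k (1 - \<delta>)
      \<le> half_binomial k 1 ^ 3 * half_binomial k (1 + 2 * \<delta>) * (1 + C * \<delta> ^ 3) ^ k"
  shows "((1 + \<delta>) ^ 3 * (1 - \<delta> / 2) ^ 2 / ((1 + 2 * \<delta>) * (1 + C * \<delta> ^ 3))) ^ k \<le> 16 * real k ^ 3"
proof -
  have a: "(4 ^ k * (1 + \<delta>) ^ k / (2 * real k)) ^ 3 * ((1 + (1 - \<delta>)) ^ (2 * k) / 2)
      \<le> half_binomial k (1 + \<delta>) ^ 3 * half_binomial k (1 - \<delta>)"
    using assms
    by (intro mult_mono power_mono half_binomial_ge_last half_binomial_ge_half)
      (auto intro!: less_imp_le[OF half_binomial_pos])
  have b: "half_binomial k 1 ^ 3 * half_binomial k (1 + 2 * \<delta>) * (1 + C * \<delta> ^ 3) ^ k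
      \<le> (4 ^ k * 1 ^ k) ^ 3 * (4 ^ k * (1 + 2 * \<delta>) ^ k) * (1 + C * \<delta> ^ 3) ^ k"
    using assms
    by (intro mult_mono power_mono half_binomial_le)
      (auto intro!: mult_nonneg_nonneg less_imp_le[OF half_binomial_pos])
  have four: "(2 - \<delta>) ^ (2 * k) = 4 ^ k * ((1 - \<delta> / 2) ^ 2) ^ k"
  proof -
    have "(2 - \<delta>) ^ 2 = 4 * (1 - \<delta> / 2) ^ 2"
      by (simp add: power2_eq_square algebra_simps)
    then show ?thesis
      by (simp only: power_mult power_mult_distrib)
  qed
  \<comment> \<open>Every one of the four values contributes one factor \<open>4 ^ k\<close>, so
    \<open>Q ^ 4\<close> cancels.\<close>
  define Q where "Q = (4::real) ^ k"
  have "Q > 0" by (simp add: Q_def)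
  have "(Q * (1 + \<delta>) ^ k / (2 * real k)) ^ 3 * (Q * ((1 - \<delta> / 2) ^ 2) ^ k / 2)
    \<le> Q ^ 3 * (Q * (1 + 2 * \<delta>) ^ k) * (1 + C * \<delta> ^ 3) ^ k"
    using order_trans[OF order_trans[OF a cross] b] four by (simp add: Q_def)
  moreover have "(Q * a ^ k / (2 * real k)) ^ 3 * (Q * b ^ k / 2) = Q ^ 4 * ((a ^ 3 * b) ^ k / (16 * real k ^ 3))"
    for a b :: real
  proof -
    have "(a ^ 3 * b) ^ k = (a ^ k) ^ 3 * b ^ k"
      by (simp add: power_mult_distrib flip: power_mult) (simp add: mult.commute)
    then show ?thesis
      by (simp add: power4_eq_xxxx power3_eq_cube mult_ac)
  qed
  moreover have "Q ^ 3 * (Q * a ^ k) * b ^ k = Q ^ 4 * (a * b) ^ k" for a b :: real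
    by (simp add: power_mult_distrib power4_eq_xxxx power3_eq_cube)
  ultimately have "((1 + \<delta>) ^ 3 * (1 - \<delta> / 2) ^ 2) ^ k / (16 * real k ^ 3)
    \<le> ((1 + 2 * \<delta>) * (1 + C * \<delta> ^ 3)) ^ k"
    using \<open>Q > 0\<close> by (simp only: mult_le_cancel_left_pos zero_less_power)
  moreover have "0 < ((1 + 2 * \<delta>) * (1 + C * \<delta> ^ 3)) ^ k"
    using assms by (intro zero_less_power mult_pos_pos add_pos_nonneg) simp_all
  ultimately show ?thesis
    using assms by (simp only: power_divide) (simp add: divide_le_eq mult_ac)
qed

text \<open>Without the error factor, the numerator exceeds the denominator by
  \<open>\<delta> ^ 2 / 4\<close> to leading order; this is the jump of the second derivative at 1.
  The choice of \<open>\<delta>\<close> turns the error \<open>C * \<delta> ^ 3\<close> into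
  \<open>\<delta> ^ 2 / 8\<close>, which uses up only half of that gain.\<close>

lemma third_difference_ratio_gt_1:
  fixes C \<delta> :: real
  assumes "48 \<le> C" and \<delta>_def: "\<delta> = 1 / (8 * C)"
  shows "1 < (1 + \<delta>) ^ 3 * (1 - \<delta> / 2) ^ 2 / ((1 + 2 * \<delta>) * (1 + C * \<delta> ^ 3))"
proof -
  have C: "C * \<delta> = 1 / 8" and \<delta>: "0 < \<delta>"
    using assms by simp_all
  have \<delta>384: "\<delta> \<le> 1 / 384"
    using mult_right_mono[OF assms(1), of \<delta>] C \<delta> by simp
  have "C * \<delta> ^ 3 = (C * \<delta>) * \<delta> ^ 2" by (simp add: power3_eq_cube power2_eq_square)
  then have C3: "C * \<delta> ^ 3 = \<delta> ^ 2 / 8" by (simp add: C)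
  have "(1 + \<delta>) ^ 3 * (1 - \<delta> / 2) ^ 2 - (1 + 2 * \<delta>) * (1 + \<delta> ^ 2 / 8)
    = \<delta> ^ 2 * (1 / 8 - 3 / 2 * \<delta> - \<delta> ^ 2 / 4 + \<delta> ^ 3 / 4)"
    by (simp add: power2_eq_square power3_eq_cube field_simps)
  moreover have "\<delta> ^ 2 \<le> \<delta>" using \<delta> \<delta>384 by (simp add: power2_eq_square mult_left_le)
  then have "0 < 1 / 8 - 3 / 2 * \<delta> - \<delta> ^ 2 / 4 + \<delta> ^ 3 / 4"
    using \<delta>384 zero_less_power[OF \<delta>, of 3] by linarith
  ultimately have "(1 + 2 * \<delta>) * (1 + \<delta> ^ 2 / 8) < (1 + \<delta>) ^ 3 * (1 - \<delta> / 2) ^ 2"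
    using \<delta> by (smt (verit) mult_pos_pos zero_less_power)
  moreover have "0 < (1 + 2 * \<delta>) * (1 + \<delta> ^ 2 / 8)"
    using \<delta> by (auto intro!: mult_pos_pos add_pos_nonneg)
  ultimately show ?thesis by (simp add: C3)
qed

text \<open>If no root lay in the sector, all roots would keep a distance \<open>d\<close> from the
  points \<open>x \<ge> 1\<close>, with \<open>d\<close> independent of \<open>k\<close>. The third
  difference bound would then give \<open>\<rho> ^ k \<le> 16 * real k ^ 3\<close> with a fixed
  \<open>\<rho> > 1\<close>, which is false for large \<open>k\<close>.\<close>

lemma half_binomial_root_small_argument:
  fixes \<epsilon> :: real
  assumes "0 < \<epsilon>"
  obtains k z where "half_binomial k (z::complex) = 0" "0 < Im z" "Im z \<le> \<epsilon> * Re z"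
proof -
  \<comment> \<open>Points with \<open>Re z \<le> 1 / 2\<close> are at least 1 / 2 away from every
    \<open>x \<ge> 1\<close>; a point further right outside the sector has
    \<open>\<bar>Im z\<bar> > e / 2\<close>. Capping \<open>e\<close> at 1 lets
    \<open>d = e / 2\<close> serve in both cases.\<close>
  define e where "e = min \<epsilon> 1"
  define d where "d = e / 2"
  define C where "C = 3 / d ^ 4"
  define \<delta> where "\<delta> = 1 / (8 * C)"
  have e: "0 < e" "e \<le> 1" "e \<le> \<epsilon>" and d: "0 < d" "d \<le> 1 / 2" "d \<le> 1"
    using assms by (auto simp: e_def d_def)
  have "d ^ 4 \<le> (1 / 2) ^ 4" using d by (intro power_mono) auto
  then have C: "48 \<le> C" using d by (simp add: C_def field_simps)
  then have \<delta>: "0 < \<delta>" "\<delta> \<le> 1" by (simp_all add: \<delta>_def field_simps)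
  define \<rho> where "\<rho> = (1 + \<delta>) ^ 3 * (1 - \<delta> / 2) ^ 2 / ((1 + 2 * \<delta>) * (1 + C * \<delta> ^ 3))"
  have "1 < \<rho>" unfolding \<rho>_def by (rule third_difference_ratio_gt_1[OF C \<delta>_def])
  then have "eventually (\<lambda>k::nat. 16 * real k ^ 3 < \<rho> ^ k) at_top" by real_asymp
  then have "eventually (\<lambda>k. 0 < k \<and> 16 * real k ^ 3 < \<rho> ^ k) at_top"
    using eventually_gt_at_top[of 0] by eventually_elim auto
  then obtain k where k: "0 < k" "16 * real k ^ 3 < \<rho> ^ k"
    by (auto simp: eventually_at_top_linorder)
  have "\<exists>z. half_binomial k (z::complex) = 0 \<and> \<bar>Im z\<bar> \<le> e * Re z \<and> 0 < Re z"
  proof (rule ccontr)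
    assume no: "\<not> ?thesis"
    define p :: "complex poly" where "p = (\<Sum>i\<le>k. monom (of_nat (2 * k choose i)) i)"
    have p: "poly p z = half_binomial k z" for z
      by (simp add: p_def poly_sum poly_monom half_binomial_def)
    have "degree p \<le> k"
      unfolding p_def by (intro degree_sum_le) (auto intro: order_trans[OF degree_monom_le])
    have far: "d \<le> cmod (of_real x - z)" if "poly p z = 0" "1 \<le> x" for x z
    proof (cases "Re z \<le> 1 / 2")
      case True
      then have "d \<le> \<bar>Re (of_real x - z)\<bar>" using that d by simp
      then show ?thesis using abs_Re_le_cmod order_trans by blast
    next
      case False
      then have "e * Re z < \<bar>Im z\<bar>" using no that p by force
      moreover have "e * (1 / 2) \<le> e * Re z" using False e by (intro mult_left_mono) auto
      ultimately have "d \<le> \<bar>Im (of_real x - z)\<bar>" by (simp add: d_def)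
      then show ?thesis using abs_Im_le_cmod order_trans by blast
    qed
    have norm_p: "cmod (poly p (of_real x)) = half_binomial k x" if "0 \<le> x" for x
      using half_binomial_pos[OF that, of k] by (simp add: p half_binomial_of_real)
    have "cmod (poly p (of_real (1 + \<delta>))) ^ 3 * cmod (poly p (of_real (1 - \<delta>)))
      \<le> cmod (poly p (of_real 1)) ^ 3 * cmod (poly p (of_real (1 + 2 * \<delta>))) * (1 + C * \<delta> ^ 3) ^ degree p"
      unfolding C_def
      using poly_cross_ratio_le[OF \<delta> d(1,3), of p] far[of _ 1] far[of _ "1 + 2 * \<delta>"] \<delta> by simp
    then have "half_binomial k (1 + \<delta>) ^ 3 * half_binomial k (1 - \<delta>)
      \<le> half_binomial k 1 ^ 3 * half_binomial k (1 + 2 * \<delta>) * (1 + C * \<delta> ^ 3) ^ degree p"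
      using \<delta> by (simp add: norm_p del: of_real_add of_real_diff of_real_mult of_real_1)
    also have "\<dots> \<le> half_binomial k 1 ^ 3 * half_binomial k (1 + 2 * \<delta>) * (1 + C * \<delta> ^ 3) ^ k"
      using \<delta> C \<open>degree p \<le> k\<close>
      by (intro mult_left_mono power_increasing mult_nonneg_nonneg zero_le_power
          less_imp_le[OF half_binomial_pos]) auto
    finally have "\<rho> ^ k \<le> 16 * real k ^ 3"
      unfolding \<rho>_def using \<delta> C k by (intro half_binomial_third_difference) auto
    then show False using k by simp
  qed
  then obtain z where z: "half_binomial k (z::complex) = 0" "\<bar>Im z\<bar> \<le> e * Re z" "0 < Re z"
    by blast
  \<comment> \<open>A real root here would be a positive number, where all terms are nonnegative and
    the constant term is 1.\<close>
  have "Im z \<noteq> 0"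
  proof
    assume "Im z = 0"
    then have "z = of_real (Re z)" by (simp add: complex_eq_iff)
    then have "half_binomial k (Re z) = 0"
      using z(1) half_binomial_of_real[of k "Re z"] by simp
    then show False using half_binomial_pos[of "Re z" k] z(3) by simp
  qed
  \<comment> \<open>The coefficients are real, so conjugation moves the root into the upper half
    plane.\<close>
  define w where "w = (if 0 < Im z then z else cnj z)"
  have "half_binomial k w = 0"
    using z(1) cnj_half_binomial[of k z] by (simp add: w_def)
  moreover have "0 < Im w" "Im w \<le> e * Re w"
    using z \<open>Im z \<noteq> 0\<close> by (auto simp: w_def)
  moreover have "e * Re w \<le> \<epsilon> * Re w"
    using z e by (auto simp: w_def)
  ultimately show ?thesis using that by force
qed

subsection \<open>Volumes by slicing\<close>

abbreviation dilate :: "real \<Rightarrow> (nat \<Rightarrow> real) set \<Rightarrow> (nat \<Rightarrow> real) set"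
  where "dilate s K \<equiv> (\<lambda>x. s *\<^sub>R x) ` K"

definition eucl :: "nat \<Rightarrow> (nat \<Rightarrow> real) set"
  where "eucl n = {x. \<forall>i\<ge>n. x i = 0}"

definition unit_vec :: "nat \<Rightarrow> nat \<Rightarrow> real"
  where "unit_vec i = (\<lambda>j. if j = i then 1 else 0)"

text \<open>The extended-valued form of \<open>vol\<close>: slices can be integrated without
  integrability conditions.\<close>

definition emeas :: "nat \<Rightarrow> (nat \<Rightarrow> real) set \<Rightarrow> ennreal"
  where "emeas n K = emeasure (PiM {..<n} (\<lambda>_. lborel)) ((\<lambda>x. restrict x {..<n}) ` K)"

lemma scaleR_apply: "(c *\<^sub>R f) i = c * (f i :: real)"
  by (simp add: scaleR_fun_def)

text \<open>\<open>Euclidean_space n\<close> carries the subspace topology of the function type, so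
  compactness can be tested in the whole space.\<close>

lemma convex_body_iff: "convex_body n K \<longleftrightarrow> K \<noteq> {} \<and> convex K \<and> compact K \<and> K \<subseteq> eucl n"
proof -
  have "Euclidean_space n = top_of_set (eucl n)"
    by (simp add: Euclidean_space_def eucl_def euclidean_product_topology)
  then show ?thesis
    by (auto simp: convex_body_def compactin_subtopology)
qed

text \<open>In the product topology continuity is checked coordinatewise. This rule and the next one
  yield compactness of dilates, sums, segments and pyramids.\<close>

lemma continuous_on_scaleR_fun:
  assumes "continuous_on S g" "continuous_on S (f :: 'a::topological_space \<Rightarrow> nat \<Rightarrow> real)"
  shows "continuous_on S (\<lambda>x. g x *\<^sub>R f x)"
  unfolding scaleR_fun_def real_scaleR_def
  by (intro continuous_on_coordinatewise_then_product continuous_on_mult assms(1)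
      continuous_on_product_then_coordinatewise[OF assms(2)])

lemma continuous_on_add_fun:
  assumes "continuous_on S f" "continuous_on S (g :: 'a::topological_space \<Rightarrow> nat \<Rightarrow> real)"
  shows "continuous_on S (\<lambda>x. f x + g x)"
  unfolding plus_fun_def
  by (intro continuous_on_coordinatewise_then_product continuous_on_add
      continuous_on_product_then_coordinatewise[OF assms(1)] continuous_on_product_then_coordinatewise[OF assms(2)])

lemmas continuous_intros_fun = continuous_on_scaleR_fun continuous_on_add_fun continuous_intros

lemma compact_dilate: "compact K \<Longrightarrow> compact (dilate s K)"
  by (intro compact_continuous_image continuous_intros_fun)

lemma compact_set_plus_fun:
  fixes K E :: "(nat \<Rightarrow> real) set"
  assumes "compact K" "compact E"
  shows "compact (K + E)"
proof -
  have "K + E = (\<lambda>p. fst p + snd p) ` (K \<times> E)"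
    by (force simp: set_plus_def)
  moreover have "compact \<dots>"
    using assms by (intro compact_continuous_image compact_Times continuous_intros_fun)
  ultimately show ?thesis by simp
qed

section \<open>Measure of a compact set by integration over slices\<close>

text \<open>Extension by zero inverts restriction on \<open>eucl n\<close>. As a preimage, the set
  inherits measurability from that map.\<close>

lemma restrict_image_eq_vimage:
  assumes "S \<subseteq> eucl n"
  shows "(\<lambda>x. restrict x {..<n}) ` S
    = (\<lambda>f i. if i < n then f i else 0) -` S \<inter> space (PiM {..<n} (\<lambda>_. lborel))"
proof (intro equalityI subsetI)
  fix f assume "f \<in> (\<lambda>x. restrict x {..<n}) ` S"
  then obtain x where x: "x \<in> S" "f = restrict x {..<n}" by auto
  then have "(\<lambda>i. if i < n then f i else 0) = x"
    using assms by (auto simp: eucl_def fun_eq_iff)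
  moreover have "f \<in> space (PiM {..<n} (\<lambda>_. lborel))"
    using x(2) by (simp add: space_PiM)
  ultimately show "f \<in> (\<lambda>f i. if i < n then f i else 0) -` S \<inter> space (PiM {..<n} (\<lambda>_. lborel))"
    using x(1) by simp
next
  fix f assume f: "f \<in> (\<lambda>f i. if i < n then f i else 0) -` S \<inter> space (PiM {..<n} (\<lambda>_. lborel))"
  then have "f = restrict (\<lambda>i. if i < n then f i else 0) {..<n}"
    by (auto simp: space_PiM PiE_def extensional_def fun_eq_iff)
  then show "f \<in> (\<lambda>x. restrict x {..<n}) ` S" using f
    by (intro image_eqI[of f _ "\<lambda>i. if i < n then f i else 0"]) auto
qed

lemma measurable_zero_extension:
  "(\<lambda>f (i::nat). if i < n then f i else 0) \<in> PiM {..<n} (\<lambda>_. lborel :: real measure) \<rightarrow>\<^sub>M borel"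
proof -
  have "(\<lambda>f (i::nat). if i < n then f i else 0) \<in> PiM {..<n} (\<lambda>_. lborel :: real measure) \<rightarrow>\<^sub>M PiM UNIV (\<lambda>_. borel)"
  proof (rule measurable_PiM_single')
    fix i
    show "(\<lambda>f. if i < n then f i else 0) \<in> PiM {..<n} (\<lambda>_. lborel :: real measure) \<rightarrow>\<^sub>M borel"
      by (cases "i < n") auto
  qed auto
  then show ?thesis
    by (simp add: measurable_cong_sets[OF refl sets_PiM_equal_borel])
qed

text \<open>Compact sets are Borel and extension by zero is measurable. The integral and the
  measurability together are what splitting off the last coordinate needs.\<close>

lemma emeas_eq_nn_integral:
  assumes "compact S" "S \<subseteq> eucl n"
  shows "emeas n S = (\<integral>\<^sup>+f. indicator S (\<lambda>i. if i < n then f i else 0) \<partial>PiM {..<n} (\<lambda>_. lborel))"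
    and "(\<lambda>f. indicator S (\<lambda>i. if i < n then f i else 0) :: ennreal)
      \<in> borel_measurable (PiM {..<n} (\<lambda>_. lborel))"
proof -
  let ?M = "PiM {..<n} (\<lambda>_. lborel :: real measure)"
  let ?ext = "\<lambda>(f :: nat \<Rightarrow> real) i. if i < n then f i else 0"
  have "S \<in> sets borel"
    using assms by (simp add: compact_imp_closed)
  then have sets: "?ext -` S \<inter> space ?M \<in> sets ?M"
    using measurable_zero_extension by (rule measurable_sets[rotated])
  show "emeas n S = (\<integral>\<^sup>+f. indicator S (?ext f) \<partial>?M)"
    unfolding emeas_def restrict_image_eq_vimage[OF assms(2)] nn_integral_indicator[OF sets, symmetric]
    by (intro nn_integral_cong) (auto simp: indicator_def)
  show "(\<lambda>f. indicator S (?ext f) :: ennreal) \<in> borel_measurable ?M"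
    using \<open>S \<in> sets borel\<close> measurable_zero_extension by measurable
qed

text \<open>Cavalieri's principle: \<open>T y\<close> is the slice of \<open>S\<close> at height
  \<open>y\<close>, moved down into \<open>eucl n\<close>. The slices are a parameter so that each
  construction can supply its own description of them.\<close>

lemma emeas_Suc:
  assumes "compact S" "S \<subseteq> eucl (Suc n)"
    and T: "\<And>y. compact (T y)" "\<And>y. T y \<subseteq> eucl n"
      "\<And>x y. x \<in> eucl n \<Longrightarrow> x + y *\<^sub>R unit_vec n \<in> S \<longleftrightarrow> x \<in> T y"
  shows "emeas (Suc n) S = (\<integral>\<^sup>+y. emeas n (T y) \<partial>lborel)"
proof -
  interpret product_sigma_finite "\<lambda>_. lborel :: real measure" by standard
  let ?ext = "\<lambda>n (f :: nat \<Rightarrow> real) i. if i < n then f i else 0"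
  have "emeas (Suc n) S = (\<integral>\<^sup>+f. indicator S (?ext (Suc n) f) \<partial>PiM (insert n {..<n}) (\<lambda>_. lborel))"
    by (simp add: emeas_eq_nn_integral(1)[OF assms(1,2)] lessThan_Suc)
  also have "\<dots> = (\<integral>\<^sup>+y. \<integral>\<^sup>+f. indicator S (?ext (Suc n) (f(n := y))) \<partial>PiM {..<n} (\<lambda>_. lborel) \<partial>lborel)"
    using emeas_eq_nn_integral(2)[OF assms(1,2)]
    by (intro product_nn_integral_insert_rev) (auto simp: lessThan_Suc)
  also have "\<dots> = (\<integral>\<^sup>+y. \<integral>\<^sup>+f. indicator (T y) (?ext n f) \<partial>PiM {..<n} (\<lambda>_. lborel) \<partial>lborel)"
  proof (intro nn_integral_cong)
    fix y :: real and f :: "nat \<Rightarrow> real"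
    have "?ext (Suc n) (f(n := y)) = ?ext n f + y *\<^sub>R unit_vec n"
      by (auto simp: fun_eq_iff unit_vec_def scaleR_apply)
    moreover have "?ext n f \<in> eucl n" by (simp add: eucl_def)
    ultimately show "indicator S (?ext (Suc n) (f(n := y))) = (indicator (T y) (?ext n f) :: ennreal)"
      using T(3)[of "?ext n f" y] by (simp add: indicator_def)
  qed
  also have "\<dots> = (\<integral>\<^sup>+y. emeas n (T y) \<partial>lborel)"
    by (simp add: emeas_eq_nn_integral(1)[OF T(1,2)])
  finally show ?thesis .
qed

text \<open>The condition on the unit vectors makes \<open>a K + b E\<close> full-dimensional for all \<open>a, b > 0\<close>.\<close>

definition volume_pair :: "nat \<Rightarrow> (nat \<Rightarrow> real) set \<Rightarrow> (nat \<Rightarrow> real) set \<Rightarrow> (real \<Rightarrow> real \<Rightarrow> real) \<Rightarrow> bool"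
  where "volume_pair n K E P \<longleftrightarrow>
    convex_body n K \<and> convex_body n E \<and> 0 \<in> K \<and> 0 \<in> E \<and>
    (\<forall>i<n. \<exists>a. a \<noteq> 0 \<and> a *\<^sub>R unit_vec i \<in> K \<union> E) \<and>
    (\<forall>s\<ge>0. \<forall>t\<ge>0. 0 \<le> P s t \<and> emeas n (dilate s K + dilate t E) = ennreal (P s t))"

text \<open>A one-point space has measure 1; the induction on the dimension of the cubes starts
  here.\<close>

lemma volume_pair_0: "volume_pair 0 {0} {0} (\<lambda>s t. 1)"
  by (auto simp: volume_pair_def convex_body_iff eucl_def emeas_def set_plus_def PiM_empty
      restrict_def emeasure_count_space)

section \<open>Prisms and their Minkowski combinations\<close>

lemma eucl_mono: "x \<in> eucl n \<Longrightarrow> x \<in> eucl (Suc n)"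
  by (simp add: eucl_def)

lemma eucl_lincomb: "x \<in> eucl n \<Longrightarrow> y \<in> eucl n \<Longrightarrow> s *\<^sub>R x + t *\<^sub>R y \<in> eucl n"
  by (simp add: eucl_def scaleR_apply)

text \<open>Coordinate \<open>n\<close> reads off the height. Uniqueness of the splitting into base
  point and height identifies the slices of prisms and pyramids.\<close>

lemma eucl_add_unit_vec_eq_iff:
  assumes "x \<in> eucl n" "x' \<in> eucl n"
  shows "x + y *\<^sub>R unit_vec n = x' + y' *\<^sub>R unit_vec n \<longleftrightarrow> x = x' \<and> y = y'"
proof
  assume eq: "x + y *\<^sub>R unit_vec n = x' + y' *\<^sub>R unit_vec n"
  have "(x + y *\<^sub>R unit_vec n) n = y" "(x' + y' *\<^sub>R unit_vec n) n = y'"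
    using assms by (auto simp: eucl_def unit_vec_def scaleR_apply)
  then have "y = y'" using eq by simp
  then show "x = x' \<and> y = y'" using eq by simp
qed simp

definition segment :: "nat \<Rightarrow> real \<Rightarrow> (nat \<Rightarrow> real) set"
  where "segment n a = (\<lambda>y. y *\<^sub>R unit_vec n) ` {0..a}"

lemma mem_lincomb:
  "x \<in> dilate s K + dilate t E \<longleftrightarrow> (\<exists>k\<in>K. \<exists>e\<in>E. x = s *\<^sub>R k + t *\<^sub>R e)"
  by (auto simp: set_plus_def)

lemma mem_plus_segment:
  "x \<in> A + segment n a \<longleftrightarrow> (\<exists>p\<in>A. \<exists>y. 0 \<le> y \<and> y \<le> a \<and> x = p + y *\<^sub>R unit_vec n)"
  by (force simp: set_plus_def segment_def)

lemma convex_body_lincomb: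
  assumes "convex_body n K" "convex_body n E"
  shows "convex_body n (dilate s K + dilate t E)"
  unfolding convex_body_iff
proof (intro conjI)
  show "dilate s K + dilate t E \<noteq> {}"
    using assms unfolding convex_body_iff ex_in_conv [symmetric] mem_lincomb by blast
  show "convex (dilate s K + dilate t E)"
    using assms by (intro convex_set_plus convex_scaling) (auto simp: convex_body_iff)
  show "compact (dilate s K + dilate t E)"
    using assms by (intro compact_set_plus_fun compact_dilate) (auto simp: convex_body_iff)
  show "dilate s K + dilate t E \<subseteq> eucl n"
    using assms by (auto simp: convex_body_iff mem_lincomb intro!: eucl_lincomb)
qed

lemma convex_body_set_plus:
  assumes "convex_body n K" "convex_body n E"
  shows "convex_body n (K + E)"
  using convex_body_lincomb[OF assms, of 1 1] by simp

lemma convex_body_Suc: "convex_body n K \<Longrightarrow> convex_body (Suc n) K"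
  by (auto simp: convex_body_iff intro: eucl_mono)

lemma convex_body_segment: "0 \<le> a \<Longrightarrow> convex_body (Suc n) (segment n a)"
  unfolding convex_body_iff
proof (intro conjI)
  assume "0 \<le> a"
  then show "segment n a \<noteq> {}" by (simp add: segment_def)
  show "convex (segment n a)"
    unfolding segment_def by (intro convex_linear_image linearI) (auto simp: scaleR_add_left)
  show "compact (segment n a)"
    unfolding segment_def by (intro compact_continuous_image continuous_intros_fun) auto
  show "segment n a \<subseteq> eucl (Suc n)"
    by (auto simp: segment_def eucl_def unit_vec_def scaleR_apply)
qed

lemma dilate_plus_segment:
  assumes "0 \<le> a" "0 \<le> b" "0 \<le> s" "0 \<le> t"
  shows "dilate s (K + segment n a) + dilate t (E + segment n b)
    = (dilate s K + dilate t E) + segment n (a * s + b * t)"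
proof (intro equalityI subsetI)
  fix x assume "x \<in> dilate s (K + segment n a) + dilate t (E + segment n b)"
  then obtain k e y z where x: "k \<in> K" "e \<in> E" "0 \<le> y" "y \<le> a" "0 \<le> z" "z \<le> b"
    "x = s *\<^sub>R (k + y *\<^sub>R unit_vec n) + t *\<^sub>R (e + z *\<^sub>R unit_vec n)"
    unfolding mem_lincomb Bex_def mem_plus_segment by blast
  then have "x = (s *\<^sub>R k + t *\<^sub>R e) + (y * s + z * t) *\<^sub>R unit_vec n"
    by (simp add: algebra_simps)
  moreover have "0 \<le> y * s + z * t" "y * s + z * t \<le> a * s + b * t"
    using x assms by (auto intro!: add_mono mult_right_mono)
  moreover have "s *\<^sub>R k + t *\<^sub>R e \<in> dilate s K + dilate t E"
    using x by (intro set_plus_intro) auto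
  ultimately show "x \<in> (dilate s K + dilate t E) + segment n (a * s + b * t)"
    unfolding mem_plus_segment by blast
next
  fix x assume "x \<in> (dilate s K + dilate t E) + segment n (a * s + b * t)"
  then obtain k e y where x: "k \<in> K" "e \<in> E" "0 \<le> y" "y \<le> a * s + b * t"
    "x = s *\<^sub>R k + t *\<^sub>R e + y *\<^sub>R unit_vec n"
    unfolding mem_plus_segment Bex_def mem_lincomb by blast
  \<comment> \<open>Both segments are used up to the same fraction \<open>u\<close>. If the total
    height is 0, then \<open>y = 0\<close>, and \<open>u = 0\<close> from the division by zero still
    fits.\<close>
  define u where "u = y / (a * s + b * t)"
  have u: "0 \<le> u" "u \<le> 1" using x assms by (auto simp: u_def divide_le_eq)
  have "y = u * (a * s + b * t)" using x by (auto simp: u_def)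
  then have "x = s *\<^sub>R (k + (u * a) *\<^sub>R unit_vec n) + t *\<^sub>R (e + (u * b) *\<^sub>R unit_vec n)"
    using x by (simp add: algebra_simps)
  moreover have "0 \<le> u * a" "u * a \<le> a" "0 \<le> u * b" "u * b \<le> b"
    using u assms by (simp_all add: mult_left_le_one_le)
  then have "k + (u * a) *\<^sub>R unit_vec n \<in> K + segment n a" "e + (u * b) *\<^sub>R unit_vec n \<in> E + segment n b"
    using x(1,2) unfolding mem_plus_segment by blast+
  ultimately show "x \<in> dilate s (K + segment n a) + dilate t (E + segment n b)"
    unfolding mem_lincomb by blast
qed

text \<open>The combination is a prism of height \<open>a * s + b * t\<close> over the combination
  of the bases, so its slices are constant. A positive \<open>a\<close> or \<open>b\<close> provides
  the new direction \<open>unit_vec n\<close>.\<close>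

lemma volume_pair_prism:
  assumes "volume_pair n K E P" and ab: "0 \<le> a" "0 \<le> b" "0 < a \<or> 0 < b"
  shows "volume_pair (Suc n) (K + segment n a) (E + segment n b) (\<lambda>s t. (a * s + b * t) * P s t)"
  unfolding volume_pair_def
proof (intro conjI allI impI)
  note KE = assms(1)[unfolded volume_pair_def]
  show "convex_body (Suc n) (K + segment n a)" "convex_body (Suc n) (E + segment n b)"
    using KE ab by (simp_all add: convex_body_Suc convex_body_set_plus convex_body_segment)
  have 0: "0 \<in> K" "0 \<in> E" "0 \<in> segment n a" "0 \<in> segment n b"
    using KE ab by (auto simp: segment_def intro!: image_eqI[of _ _ 0])
  show "0 \<in> K + segment n a" "0 \<in> E + segment n b"
    using set_plus_intro[OF 0(1,3)] set_plus_intro[OF 0(2,4)] by auto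
  show "\<exists>c. c \<noteq> 0 \<and> c *\<^sub>R unit_vec i \<in> (K + segment n a) \<union> (E + segment n b)" if "i < Suc n" for i
  proof (cases "i < n")
    case True
    then obtain c where c: "c \<noteq> 0" "c *\<^sub>R unit_vec i \<in> K \<union> E" using KE by blast
    then have "c *\<^sub>R unit_vec i + 0 \<in> (K + segment n a) \<union> (E + segment n b)"
      using 0 by (auto simp del: add_0_right intro: set_plus_intro)
    then show ?thesis using c by auto
  next
    case False
    then have "i = n" using that by simp
    have "a *\<^sub>R unit_vec n \<in> segment n a" "b *\<^sub>R unit_vec n \<in> segment n b"
      using ab by (auto simp: segment_def)
    then have "0 + a *\<^sub>R unit_vec n \<in> K + segment n a" "0 + b *\<^sub>R unit_vec n \<in> E + segment n b"
      using 0 by (auto simp del: add_0_left intro: set_plus_intro)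
    then show ?thesis using ab unfolding \<open>i = n\<close> by (metis UnI1 UnI2 add_0_left less_irrefl)
  qed
  fix s t :: real assume st: "0 \<le> s" "0 \<le> t"
  have P: "0 \<le> P s t" "emeas n (dilate s K + dilate t E) = ennreal (P s t)"
    using KE st by auto
  define A where "A = dilate s K + dilate t E"
  define h where "h = a * s + b * t"
  have h: "0 \<le> h" using ab st by (simp add: h_def)
  then show "0 \<le> (a * s + b * t) * P s t" using P by (simp add: h_def)
  have A: "convex_body n A" using KE by (simp add: A_def convex_body_lincomb)
  then have S: "convex_body (Suc n) (A + segment n h)"
    using h by (simp add: convex_body_Suc convex_body_set_plus convex_body_segment)
  have "emeas (Suc n) (A + segment n h) = (\<integral>\<^sup>+y. emeas n (if y \<in> {0..h} then A else {}) \<partial>lborel)"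
  proof (rule emeas_Suc)
    show "x + y *\<^sub>R unit_vec n \<in> A + segment n h \<longleftrightarrow> x \<in> (if y \<in> {0..h} then A else {})"
      if "x \<in> eucl n" for x y
    proof -
      have "A \<subseteq> eucl n" using A by (simp add: convex_body_iff)
      then have "x + y *\<^sub>R unit_vec n = x' + y' *\<^sub>R unit_vec n \<longleftrightarrow> x = x' \<and> y = y'" if "x' \<in> A" for x' y'
        using that \<open>x \<in> eucl n\<close> by (intro eucl_add_unit_vec_eq_iff) auto
      then show ?thesis
        by (auto simp: mem_plus_segment)
    qed
  qed (use A S in \<open>auto simp: convex_body_iff\<close>)
  also have "\<dots> = (\<integral>\<^sup>+y. ennreal (P s t) * indicator {0..h} y \<partial>lborel)"
    using P by (intro nn_integral_cong) (auto simp: A_def emeas_def indicator_def)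
  also have "\<dots> = ennreal (h * P s t)"
    using h P by (simp add: nn_integral_cmult_indicator ennreal_mult mult.commute)
  finally show "emeas (Suc n) (dilate s (K + segment n a) + dilate t (E + segment n b))
    = ennreal ((a * s + b * t) * P s t)"
    unfolding dilate_plus_segment[OF ab(1,2) st] A_def h_def .
qed

section \<open>Pyramids and integration in the first parameter\<close>

definition pyramid :: "nat \<Rightarrow> (nat \<Rightarrow> real) set \<Rightarrow> (nat \<Rightarrow> real) set"
  where "pyramid n K = convex hull (insert (unit_vec n) K)"

text \<open>Sorting the points by height \<open>y\<close> shows the slices
  \<open>(1 - y) *\<^sub>R K\<close> and, as a continuous image of a compact set, gives
  compactness.\<close>

lemma pyramid_eq:
  assumes "convex_body n K"
  shows "pyramid n K = (\<lambda>(y, k). (1 - y) *\<^sub>R k + y *\<^sub>R unit_vec n) ` ({0..1} \<times> K)"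
proof -
  have "K \<noteq> {}" "convex hull K = K" using assms by (auto simp: convex_body_iff convex_hull_eq)
  then show ?thesis
    unfolding pyramid_def convex_hull_insert[OF \<open>K \<noteq> {}\<close>] \<open>convex hull K = K\<close>
  proof (intro equalityI subsetI)
    fix x assume "x \<in> {x. \<exists>u\<ge>0. \<exists>v\<ge>0. \<exists>b. u + v = 1 \<and> b \<in> K \<and> x = u *\<^sub>R unit_vec n + v *\<^sub>R b}"
    then obtain u v b where x: "0 \<le> u" "0 \<le> v" "u + v = 1" "b \<in> K" "x = u *\<^sub>R unit_vec n + v *\<^sub>R b"
      by blast
    then have "v = 1 - u" by simp
    then show "x \<in> (\<lambda>(y, k). (1 - y) *\<^sub>R k + y *\<^sub>R unit_vec n) ` ({0..1} \<times> K)"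
      using x by (intro image_eqI[of _ _ "(u, b)"]) (auto simp: add.commute)
  next
    fix x assume "x \<in> (\<lambda>(y, k). (1 - y) *\<^sub>R k + y *\<^sub>R unit_vec n) ` ({0..1} \<times> K)"
    then obtain y k where x: "0 \<le> y" "y \<le> 1" "k \<in> K" "x = (1 - y) *\<^sub>R k + y *\<^sub>R unit_vec n"
      by auto
    then have "0 \<le> 1 - y" "y + (1 - y) = 1" "x = y *\<^sub>R unit_vec n + (1 - y) *\<^sub>R k"
      by (simp_all add: add.commute)
    then show "x \<in> {x. \<exists>u\<ge>0. \<exists>v\<ge>0. \<exists>b. u + v = 1 \<and> b \<in> K \<and> x = u *\<^sub>R unit_vec n + v *\<^sub>R b}"
      using x by blast
  qed
qed

lemma convex_body_pyramid:
  assumes "convex_body n K"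
  shows "convex_body (Suc n) (pyramid n K)"
  unfolding convex_body_iff
proof (intro conjI)
  show "pyramid n K \<noteq> {}" "convex (pyramid n K)" by (auto simp: pyramid_def)
  show "compact (pyramid n K)"
    unfolding pyramid_eq[OF assms] case_prod_beta using assms
    by (intro compact_continuous_image compact_Times continuous_intros_fun) (auto simp: convex_body_iff)
  show "pyramid n K \<subseteq> eucl (Suc n)"
    unfolding pyramid_eq[OF assms] using assms
    by (auto simp: convex_body_iff unit_vec_def eucl_def scaleR_apply subset_iff)
qed

text \<open>\<open>E\<close> has no extent in the new direction, so the slice of the combination at
  height \<open>y\<close> is the combination of \<open>K\<close> and \<open>E\<close> with
  parameters \<open>s - y\<close> and \<open>t\<close>. The volume is therefore the integral of
  \<open>P\<close> in its first argument from 0 to \<open>s\<close>.\<close>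

lemma volume_pair_pyramid:
  assumes "volume_pair n K E P"
    and Q: "\<And>t. Q 0 t = 0" "\<And>s t. ((\<lambda>s. Q s t) has_real_derivative P s t) (at s)"
      "\<And>t. continuous_on UNIV (\<lambda>s. P s t)"
  shows "volume_pair (Suc n) (pyramid n K) E Q"
  unfolding volume_pair_def
proof (intro conjI allI impI)
  note KE = assms(1)[unfolded volume_pair_def]
  show "convex_body (Suc n) (pyramid n K)" "convex_body (Suc n) E"
    using KE by (simp_all add: convex_body_Suc convex_body_pyramid)
  have K: "insert (unit_vec n) K \<subseteq> pyramid n K"
    unfolding pyramid_def by (rule hull_subset)
  then show "0 \<in> pyramid n K" "0 \<in> E" using KE by auto
  show "\<exists>c. c \<noteq> 0 \<and> c *\<^sub>R unit_vec i \<in> pyramid n K \<union> E" if "i < Suc n" for i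
  proof (cases "i < n")
    case True
    then show ?thesis using KE K by blast
  next
    case False
    then have "i = n" using that by simp
    then show ?thesis using K by (intro exI[of _ 1]) auto
  qed
  fix s t :: real assume st: "0 \<le> s" "0 \<le> t"
  define S where "S = dilate s (pyramid n K) + dilate t E"
  define T where "T y = (if y \<in> {0..s} then dilate (s - y) K + dilate t E else {})" for y
  have S: "convex_body (Suc n) S"
    unfolding S_def using KE by (intro convex_body_lincomb convex_body_pyramid convex_body_Suc) auto
  have T: "convex_body n (dilate (s - y) K + dilate t E)" for y
    using KE by (simp add: convex_body_lincomb)
  have "emeas (Suc n) S = (\<integral>\<^sup>+y. emeas n (T y) \<partial>lborel)"
  proof (rule emeas_Suc)
    fix x :: "nat \<Rightarrow> real" and y :: real assume x: "x \<in> eucl n"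
    show "x + y *\<^sub>R unit_vec n \<in> S \<longleftrightarrow> x \<in> T y"
    proof
      assume "x + y *\<^sub>R unit_vec n \<in> S"
      then obtain k e z where z: "k \<in> K" "e \<in> E" "0 \<le> z" "z \<le> 1"
        "x + y *\<^sub>R unit_vec n = s *\<^sub>R ((1 - z) *\<^sub>R k + z *\<^sub>R unit_vec n) + t *\<^sub>R e"
        using KE by (auto simp: S_def mem_lincomb pyramid_eq)
      moreover have "\<dots> = ((s - s * z) *\<^sub>R k + t *\<^sub>R e) + (s * z) *\<^sub>R unit_vec n"
        by (simp add: algebra_simps)
      moreover have "(s - s * z) *\<^sub>R k + t *\<^sub>R e \<in> eucl n"
        using z KE by (intro eucl_lincomb) (auto simp: convex_body_iff)
      ultimately have "x = (s - s * z) *\<^sub>R k + t *\<^sub>R e" "y = s * z"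
        using eucl_add_unit_vec_eq_iff[OF x] by metis+
      then show "x \<in> T y"
        using z st by (auto simp: T_def mult_left_le mem_lincomb)
    next
      assume "x \<in> T y"
      then have y: "0 \<le> y" "y \<le> s" and "x \<in> dilate (s - y) K + dilate t E"
        by (auto simp: T_def split: if_splits)
      then obtain k e where ke: "k \<in> K" "e \<in> E" "x = (s - y) *\<^sub>R k + t *\<^sub>R e"
        by (auto simp: mem_lincomb)
      \<comment> \<open>The relative height in the undilated pyramid. For \<open>s = 0\<close> also
        \<open>y = 0\<close>, and \<open>z = 0\<close> is a valid choice.\<close>
      define z where "z = y / s"
      have z: "0 \<le> z" "z \<le> 1" "y = s * z" using y by (auto simp: z_def divide_le_eq)
      then have "x + y *\<^sub>R unit_vec n = s *\<^sub>R ((1 - z) *\<^sub>R k + z *\<^sub>R unit_vec n) + t *\<^sub>R e"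
        using ke by (simp add: algebra_simps)
      moreover have "(1 - z) *\<^sub>R k + z *\<^sub>R unit_vec n \<in> pyramid n K"
        using KE z ke by (auto simp: pyramid_eq image_iff intro!: bexI[of _ z] bexI[of _ k])
      ultimately show "x + y *\<^sub>R unit_vec n \<in> S"
        using ke unfolding S_def mem_lincomb by blast
    qed
  qed (use S T in \<open>auto simp: convex_body_iff T_def\<close>)
  also have "\<dots> = (\<integral>\<^sup>+y. ennreal (P (s - y) t) * indicator {0..s} y \<partial>lborel)"
    using KE st by (intro nn_integral_cong) (auto simp: T_def emeas_def indicator_def)
  also have "\<dots> = (- Q (s - s) t) - (- Q (s - 0) t)"
  proof (rule nn_integral_FTC_Icc)
    show "(\<lambda>y. P (s - y) t) \<in> borel_measurable borel"
      by (intro borel_measurable_continuous_onI continuous_on_compose2[OF Q(3)] continuous_intros) auto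
    fix y assume "y \<in> {0..s}"
    then show "0 \<le> P (s - y) t" using KE st by auto
    have "((\<lambda>y. s - y) has_real_derivative - 1) (at y)"
      by (auto intro!: derivative_eq_intros)
    then show "((\<lambda>y. - Q (s - y) t) has_real_derivative P (s - y) t) (at y)"
      using DERIV_minus[OF DERIV_chain2[OF Q(2)]] by fastforce
  qed (use st in auto)
  finally show "emeas (Suc n) (dilate s (pyramid n K) + dilate t E) = ennreal (Q s t)"
    by (simp add: S_def Q(1))
  have "Q 0 t \<le> Q s t"
    by (rule DERIV_nonneg_imp_nondecreasing[OF st(1)]) (use Q(2) KE st in blast)
  then show "0 \<le> Q s t" by (simp add: Q(1))
qed

subsection \<open>Steiner polynomials and their roots\<close>

lemma sum_fun_apply: "(\<Sum>i\<in>A. f i) x = (\<Sum>i\<in>A. f i x :: real)"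
  by (induction A rule: infinite_finite_induct) auto

lemma inj_unit_vec: "inj unit_vec"
  by (auto simp: inj_def unit_vec_def fun_eq_iff split: if_splits)

text \<open>The affine hull passes through 0, so it contains all unit vectors below
  \<open>n\<close>. The direction space lies between this independent set and its span.\<close>

lemma affine_hull_dim_eqI:
  assumes "S \<subseteq> eucl n" "0 \<in> S" "\<And>i. i < n \<Longrightarrow> \<exists>a. a \<noteq> 0 \<and> a *\<^sub>R unit_vec i \<in> S"
  shows "affine_hull_dim S = n"
proof -
  define B where "B = unit_vec ` {..<n}"
  define D where "D = {x - y |x y. x \<in> affine hull S \<and> y \<in> affine hull S}"
  have zero: "0 \<in> affine hull S" using assms(2) by (rule hull_inc)
  have "B \<subseteq> D"
  proof
    fix v assume "v \<in> B"
    then obtain i where i: "i < n" "v = unit_vec i" by (auto simp: B_def)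
    then obtain a where a: "a \<noteq> 0" "a *\<^sub>R v \<in> S" using assms(3) by blast
    \<comment> \<open>An affine combination with 0 rescales by any factor.\<close>
    then have "(1 / a) *\<^sub>R (a *\<^sub>R v) + (1 - 1 / a) *\<^sub>R 0 \<in> affine hull S"
      by (intro mem_affine[OF affine_affine_hull] zero hull_inc) auto
    then have "v \<in> affine hull S" using a by simp
    then have "v - 0 \<in> D" unfolding D_def using zero by blast
    then show "v \<in> D" by simp
  qed
  have "affine (eucl n)"
    by (auto simp: affine_def intro: eucl_lincomb)
  then have "affine hull S \<subseteq> eucl n" using assms(1) by (intro hull_minimal)
  moreover have "x - y \<in> eucl n" if "x \<in> eucl n" "y \<in> eucl n" for x y
    using eucl_lincomb[OF that, of 1 "- 1"] by simp
  ultimately have "D \<subseteq> eucl n" unfolding D_def by blast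
  also have "eucl n \<subseteq> span B"
  proof
    fix x assume x: "x \<in> eucl n"
    have "(\<Sum>i<n. x i *\<^sub>R unit_vec i) j = x j" for j
      using x by (simp add: sum_fun_apply scaleR_apply unit_vec_def eucl_def if_distrib sum.delta cong: if_cong)
    then have "x = (\<Sum>i<n. x i *\<^sub>R unit_vec i)" by (simp add: fun_eq_iff)
    also have "\<dots> \<in> span B"
      by (intro span_sum span_scale span_base) (auto simp: B_def)
    finally show "x \<in> span B" .
  qed
  finally have "D \<subseteq> span B" .
  moreover have "independent B"
  proof -
    have "u v = 0" if "(\<Sum>v\<in>B. u v *\<^sub>R v) = 0" "v \<in> B" for u v
    proof -
      obtain j where j: "j < n" "v = unit_vec j" using \<open>v \<in> B\<close> by (auto simp: B_def)
      have "(\<Sum>v\<in>B. u v *\<^sub>R v) = (\<Sum>i<n. u (unit_vec i) *\<^sub>R unit_vec i)"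
        unfolding B_def by (subst sum.reindex) (auto intro: inj_on_subset[OF inj_unit_vec])
      then have "(\<Sum>i<n. u (unit_vec i) *\<^sub>R unit_vec i) j = 0"
        using that(1) by simp
      moreover have "(u (unit_vec i) *\<^sub>R unit_vec i) j = (if i = j then u (unit_vec i) else 0)" for i
        by (simp add: scaleR_apply unit_vec_def)
      ultimately show ?thesis using j by (simp add: sum_fun_apply)
    qed
    then show ?thesis by (subst dependent_finite) (auto simp: B_def)
  qed
  moreover have "card B = n"
    unfolding B_def by (simp add: card_image inj_on_subset[OF inj_unit_vec])
  ultimately have "dim D = n" using \<open>B \<subseteq> D\<close> by (intro dim_unique)
  then show ?thesis by (simp add: affine_hull_dim_def D_def)
qed

section \<open>From volume polynomials to roots\<close>

text \<open>Convexity puts the weighted mean of two points of \<open>E\<close> back into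
  \<open>E\<close>. This allows a multiple of \<open>E\<close> to be absorbed into the first
  body.\<close>

lemma dilate_plus_dilate:
  assumes "convex E" "0 \<le> u" "0 \<le> v"
  shows "dilate u E + dilate v E = dilate (u + v) E"
proof (intro equalityI subsetI)
  fix x assume "x \<in> dilate (u + v) E"
  then obtain e where "e \<in> E" "x = u *\<^sub>R e + v *\<^sub>R e" by (auto simp: scaleR_add_left)
  then show "x \<in> dilate u E + dilate v E" unfolding mem_lincomb by blast
next
  fix x assume "x \<in> dilate u E + dilate v E"
  then obtain e f where x: "e \<in> E" "f \<in> E" "x = u *\<^sub>R e + v *\<^sub>R f" unfolding mem_lincomb by blast
  show "x \<in> dilate (u + v) E"
  proof (cases "u + v = 0")
    case True
    then show ?thesis using x assms by (auto simp: add_nonneg_eq_0_iff intro: image_eqI[of _ _ e])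
  next
    case False
    define g where "g = (u / (u + v)) *\<^sub>R e + (v / (u + v)) *\<^sub>R f"
    have "g \<in> E"
      unfolding g_def using x assms False
      by (intro convexD) (auto simp: add_divide_distrib [symmetric])
    moreover have "x = (u + v) *\<^sub>R g"
      using x False by (simp add: g_def scaleR_add_right)
    ultimately show ?thesis by blast
  qed
qed

text \<open>Quermassintegrals are unique, so they can be read off from any real polynomial
  \<open>q\<close> of degree at most \<open>n\<close> that gives the volumes; \<open>Q\<close> is
  its copy over the complex numbers.\<close>

lemma steiner_poly_eqI:
  assumes "degree q \<le> n" "\<And>t. 0 \<le> t \<Longrightarrow> vol n (K + dilate t E) = poly q t"
    and "\<And>i. coeff Q i = of_real (coeff q i)"
  shows "steiner_poly n K E = Q"
proof -
  define W where "W i = (if i \<le> n then coeff q i / real (n choose i) else 0)" for i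
  have W: "real (n choose i) * W i = coeff q i" if "i \<le> n" for i
    using that by (simp add: W_def)
  have "poly q t = (\<Sum>i\<le>n. coeff q i * t ^ i)" for t
    unfolding poly_altdef using assms(1)
    by (intro sum.mono_neutral_left) (auto simp: coeff_eq_0)
  then have "is_relative_quermassintegrals n K E W"
    using assms(2) by (auto simp: is_relative_quermassintegrals_def W) (simp add: W_def)
  then have "steiner_poly n K E = (\<Sum>i\<le>n. monom (of_real (real (n choose i) * W i)) i)"
    by (simp add: steiner_poly_def relative_quermassintegral_eqI)
  also have "\<dots> = (\<Sum>i\<le>n. monom (coeff Q i) i)"
    by (intro sum.cong) (simp_all add: W assms(3) del: of_real_mult)
  also have "\<dots> = Q"
  proof (rule poly_eqI)
    fix j show "coeff (\<Sum>i\<le>n. monom (coeff Q i) i) j = coeff Q j"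
      using assms(1) by (auto simp: coeff_sum assms(3) coeff_eq_0)
  qed
  finally show ?thesis .
qed

text \<open>With \<open>L\<close> as the first body, the volume polynomial of the pair has
  \<open>a\<close> and \<open>a * \<mu> + t\<close> as its arguments. At \<open>t = \<gamma>\<close>
  the second one is \<open>a * \<omega>\<close>, and homogeneity turns the value into
  \<open>a ^ n\<close> times the vanishing sum.\<close>

lemma volume_pair_root:
  fixes \<gamma> \<omega> :: complex
  assumes "volume_pair n K E (\<lambda>s t. \<Sum>i\<le>n. c i * s ^ (n - i) * t ^ i)"
    and "(\<Sum>i\<le>n. of_real (c i) * \<omega> ^ i) = 0"
    and a: "0 < a" "0 \<le> \<mu>" and \<gamma>: "\<gamma> = of_real a * (\<omega> - of_real \<mu>)" "0 \<le> Im \<gamma>"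
  shows "\<gamma> \<in> steiner_roots n"
proof -
  note KE = assms(1)[unfolded volume_pair_def]
  have E: "convex E" using KE by (simp add: convex_body_iff)
  define L where "L = dilate a K + dilate (a * \<mu>) E"
  have L: "convex_body n L" unfolding L_def using KE by (intro convex_body_lincomb) auto
  have LE: "L + dilate t E = dilate a K + dilate (a * \<mu> + t) E" if "0 \<le> t" for t
    using dilate_plus_dilate[OF E, of "a * \<mu>" t] a that by (simp add: L_def add.assoc)
  have one: "dilate 1 E = E" by simp
  have L1: "L + E = dilate a K + dilate (a * \<mu> + 1) E"
    using LE[of 1] unfolding one by simp
  have "affine_hull_dim (L + E) = n"
  proof (rule affine_hull_dim_eqI)
    show "L + E \<subseteq> eucl n"
      using KE L convex_body_set_plus[of n L E] by (simp add: convex_body_iff)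
    have 0: "0 \<in> K" "0 \<in> E" using KE by auto
    then have "0 = a *\<^sub>R (0 :: nat \<Rightarrow> real) + (a * \<mu> + 1) *\<^sub>R 0" by simp
    then show "0 \<in> L + E" unfolding L1 mem_lincomb using 0 by blast
    fix i assume "i < n"
    then obtain b where b: "b \<noteq> 0" "b *\<^sub>R unit_vec i \<in> K \<union> E" using KE by blast
    then consider "b *\<^sub>R unit_vec i \<in> K" | "b *\<^sub>R unit_vec i \<in> E" by blast
    then show "\<exists>d. d \<noteq> 0 \<and> d *\<^sub>R unit_vec i \<in> L + E"
    proof cases
      case 1
      have "(a * b) *\<^sub>R unit_vec i = a *\<^sub>R (b *\<^sub>R unit_vec i) + (a * \<mu> + 1) *\<^sub>R 0" by simp
      then have "(a * b) *\<^sub>R unit_vec i \<in> L + E"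
        unfolding L1 mem_lincomb using 1 0 by blast
      then show ?thesis using a b by (intro exI[of _ "a * b"]) auto
    next
      case 2
      have "((a * \<mu> + 1) * b) *\<^sub>R unit_vec i = a *\<^sub>R 0 + (a * \<mu> + 1) *\<^sub>R (b *\<^sub>R unit_vec i)" by simp
      then have "((a * \<mu> + 1) * b) *\<^sub>R unit_vec i \<in> L + E"
        unfolding L1 mem_lincomb using 2 0 by blast
      moreover have "a * \<mu> + 1 > 0" using a by (simp add: add_nonneg_pos)
      ultimately show ?thesis using b by (intro exI[of _ "(a * \<mu> + 1) * b"]) auto
    qed
  qed
  moreover have "poly (steiner_poly n L E) \<gamma> = 0"
  proof -
    define q where "q = (\<Sum>i\<le>n. smult (c i * a ^ (n - i)) ([:a * \<mu>, 1:] ^ i))"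
    define Q :: "complex poly"
      where "Q = (\<Sum>i\<le>n. smult (of_real (c i * a ^ (n - i))) ([:of_real (a * \<mu>), 1:] ^ i))"
    \<comment> \<open>Beyond the degree both coefficients vanish; otherwise both come from the
      binomial formula.\<close>
    have coeff_lin: "coeff ([:of_real (a * \<mu>), 1:] ^ i) j = complex_of_real (coeff ([:a * \<mu>, 1:] ^ i) j)" for i j
    proof (cases "j \<le> i")
      case False
      then have "degree ([:of_real (a * \<mu>) :: complex, 1:] ^ i) < j" "degree ([:a * \<mu>, 1:] ^ i) < j"
        by (simp_all add: degree_power_eq)
      then show ?thesis by (simp only: coeff_eq_0 of_real_0)
    qed (simp add: coeff_linear_poly_power)
    have "steiner_poly n L E = Q"
    proof (rule steiner_poly_eqI)
      show "degree q \<le> n"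
        unfolding q_def by (intro degree_sum_le) (auto intro!: order_trans[OF degree_smult_le] simp: degree_power_eq)
      show "coeff Q i = of_real (coeff q i)" for i
        by (simp add: Q_def q_def coeff_sum coeff_lin del: of_real_mult) simp
      fix t :: real assume t: "0 \<le> t"
      then have "emeas n (L + dilate t E) = ennreal (\<Sum>i\<le>n. c i * a ^ (n - i) * (a * \<mu> + t) ^ i)"
        "0 \<le> (\<Sum>i\<le>n. c i * a ^ (n - i) * (a * \<mu> + t) ^ i)"
        using KE a LE[OF t] by auto
      then show "vol n (L + dilate t E) = poly q t"
        by (simp add: vol_def measure_def emeas_def q_def poly_sum)
    qed
    also have "poly Q \<gamma> = (\<Sum>i\<le>n. of_real a ^ n * (of_real (c i) * \<omega> ^ i))"
      unfolding Q_def poly_sum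
    proof (intro sum.cong refl)
      fix i assume "i \<in> {..n}"
      then have "complex_of_real a ^ n = of_real a ^ (n - i) * of_real a ^ i"
        by (simp flip: power_add)
      moreover have "of_real (a * \<mu>) + \<gamma> = of_real a * \<omega>" by (simp add: \<gamma> algebra_simps)
      ultimately show "poly (smult (of_real (c i * a ^ (n - i))) ([:of_real (a * \<mu>), 1:] ^ i)) \<gamma>
        = of_real a ^ n * (of_real (c i) * \<omega> ^ i)"
        by (simp add: power_mult_distrib)
    qed
    also have "\<dots> = 0" using assms(2) by (simp flip: sum_distrib_left)
    finally show ?thesis .
  qed
  ultimately show ?thesis using L KE \<gamma>(2) by (auto simp: steiner_roots_def)
qed

section \<open>Explicit pairs of bodies\<close>

text \<open>The witnesses are the cubes with side lengths \<open>a\<close> and 1, built by adding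
  one segment to each body per dimension.\<close>

lemma volume_pair_cube:
  assumes "0 \<le> a"
  shows "\<exists>K E. volume_pair n K E (\<lambda>s t. (a * s + t) ^ n)"
proof (induction n)
  case 0
  then show ?case using volume_pair_0 by auto
next
  case (Suc n)
  then obtain K E where "volume_pair n K E (\<lambda>s t. (a * s + t) ^ n)" by blast
  from volume_pair_prism[OF this assms, of 1] show ?case by auto
qed

text \<open>The function is the \<open>m\<close>-fold antiderivative in \<open>s\<close> of
  \<open>(s + t) ^ k\<close>: each pyramid turns \<open>s ^ p / fact p\<close> into the next such
  term and leaves the powers of \<open>t\<close> alone.\<close>

lemma volume_pair_iterated_pyramid:
  "\<exists>K E. volume_pair (k + m) K E
    (\<lambda>s t. \<Sum>i\<le>k. fact k / (fact i * fact (k + m - i)) * s ^ (k + m - i) * t ^ i)"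
proof (induction m)
  case 0
  have "(1 * s + t) ^ k = (\<Sum>i\<le>k. fact k / (fact i * fact (k + 0 - i)) * s ^ (k + 0 - i) * t ^ i)"
    for s t :: real
    using binomial_ring[of t s k] by (simp add: add.commute binomial_fact mult_ac)
  then show ?case using volume_pair_cube[of 1 k] by simp
next
  case (Suc m)
  then obtain K E where KE: "volume_pair (k + m) K E
    (\<lambda>s t. \<Sum>i\<le>k. fact k / (fact i * fact (k + m - i)) * s ^ (k + m - i) * t ^ i)" by blast
  have "volume_pair (Suc (k + m)) (pyramid (k + m) K) E
    (\<lambda>s t. \<Sum>i\<le>k. fact k / (fact i * fact (k + Suc m - i)) * s ^ (k + Suc m - i) * t ^ i)"
  proof (rule volume_pair_pyramid[OF KE])
    show "(\<Sum>i\<le>k. fact k / (fact i * fact (k + Suc m - i)) * 0 ^ (k + Suc m - i) * t ^ i) = 0" for t :: real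
      by (intro sum.neutral) auto
    show "continuous_on UNIV (\<lambda>s. \<Sum>i\<le>k. fact k / (fact i * fact (k + m - i)) * s ^ (k + m - i) * t ^ i)"
      for t :: real by (intro continuous_intros)
    fix s t :: real
    show "((\<lambda>s. \<Sum>i\<le>k. fact k / (fact i * fact (k + Suc m - i)) * s ^ (k + Suc m - i) * t ^ i)
      has_real_derivative (\<Sum>i\<le>k. fact k / (fact i * fact (k + m - i)) * s ^ (k + m - i) * t ^ i)) (at s)"
    proof (rule DERIV_sum)
      fix i assume "i \<in> {..k}"
      then have i: "k + Suc m - i = Suc (k + m - i)" by simp
      have "((\<lambda>s. b / (d * fact (Suc p)) * s ^ Suc p * t ^ i) has_real_derivative
        b / (d * fact p) * s ^ p * t ^ i) (at s)" if "d \<noteq> 0" for b d :: real and p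
      proof (rule DERIV_cong)
        show "((\<lambda>s. b / (d * fact (Suc p)) * s ^ Suc p * t ^ i) has_real_derivative
          b / (d * fact (Suc p)) * (real (Suc p) * s ^ p) * t ^ i) (at s)"
          by (intro DERIV_cmult_right DERIV_cmult) (use DERIV_pow[of "Suc p" s] in simp)
        show "b / (d * fact (Suc p)) * (real (Suc p) * s ^ p) * t ^ i = b / (d * fact p) * s ^ p * t ^ i"
          unfolding fact_Suc of_nat_mult using that by (simp add: divide_simps)
      qed
      then show "((\<lambda>s. fact k / (fact i * fact (k + Suc m - i)) * s ^ (k + Suc m - i) * t ^ i)
        has_real_derivative fact k / (fact i * fact (k + m - i)) * s ^ (k + m - i) * t ^ i) (at s)"
        unfolding i by simp
    qed
  qed
  then show ?case by auto
qed

text \<open>Prisms over \<open>K\<close> with a segment of length 0 for \<open>E\<close> contribute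
  only factors \<open>s\<close>, which are 1 at \<open>s = 1\<close>. Roots thus persist in all
  higher dimensions.\<close>

lemma volume_pair_cylinder:
  assumes "volume_pair n K E P"
  shows "\<exists>K E. volume_pair (n + r) K E (\<lambda>s t. s ^ r * P s t)"
proof (induction r)
  case 0
  then show ?case using assms by auto
next
  case (Suc r)
  then obtain K E where "volume_pair (n + r) K E (\<lambda>s t. s ^ r * P s t)" by blast
  from volume_pair_prism[OF this, of 1 0] show ?case by (auto simp: mult.assoc)
qed

text \<open>For cubes with sides \<open>a\<close> and 1 the Steiner polynomial is the
  \<open>n\<close>-th power of \<open>z + a\<close>.\<close>

lemma nonpos_real_mem_steiner_roots:
  assumes "0 \<le> a" "0 < n"
  shows "- of_real a \<in> steiner_roots n"
proof -
  obtain K E where "volume_pair n K E (\<lambda>s t. (a * s + t) ^ n)"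
    using volume_pair_cube[OF assms(1)] by blast
  moreover have "(a * s + t) ^ n = (\<Sum>i\<le>n. (real (n choose i) * a ^ (n - i)) * s ^ (n - i) * t ^ i)" for s t
    using binomial_ring[of t "a * s" n] by (simp add: add.commute power_mult_distrib mult_ac)
  ultimately have KE: "volume_pair n K E (\<lambda>s t. \<Sum>i\<le>n. (real (n choose i) * a ^ (n - i)) * s ^ (n - i) * t ^ i)"
    by simp
  have "(\<Sum>i\<le>n. complex_of_real (real (n choose i) * a ^ (n - i)) * (- of_real a) ^ i) = (- of_real a + of_real a) ^ n"
    unfolding binomial_ring by (intro sum.cong) (simp_all add: mult_ac)
  also have "\<dots> = 0" using assms(2) by simp
  finally show ?thesis using volume_pair_root[OF KE, of "- of_real a" 1 0] by simp
qed

text \<open>Iterating the pyramid \<open>k\<close> times over two \<open>k\<close>-dimensional cubes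
  yields the coefficients of \<open>half_binomial k\<close> up to the factor
  \<open>fact k / fact (2 * k)\<close>; cylinders fill up the remaining dimensions.\<close>

lemma half_binomial_root_mem_steiner_roots:
  assumes "half_binomial k \<omega> = 0" "0 < a" "0 \<le> \<mu>" "\<gamma> = of_real a * (\<omega> - of_real \<mu>)" "0 \<le> Im \<gamma>"
    and "2 * k \<le> n"
  shows "\<gamma> \<in> steiner_roots n"
proof -
  \<comment> \<open>Padded with zeros beyond \<open>k\<close>, since the volume polynomial is summed
    up to \<open>n\<close>.\<close>
  define c where "c i = (if i \<le> k then fact k / (fact i * fact (2 * k - i)) else 0 :: real)" for i
  obtain r where n: "n = 2 * k + r" using assms(6) le_Suc_ex by blast
  obtain K E where "volume_pair (k + k) K E
    (\<lambda>s t. \<Sum>i\<le>k. fact k / (fact i * fact (k + k - i)) * s ^ (k + k - i) * t ^ i)"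
    using volume_pair_iterated_pyramid by blast
  from volume_pair_cylinder[OF this, of r] obtain K E where
    "volume_pair n K E (\<lambda>s t. s ^ r * (\<Sum>i\<le>k. fact k / (fact i * fact (2 * k - i)) * s ^ (2 * k - i) * t ^ i))"
    unfolding n mult_2 by blast
  moreover have "s ^ r * (\<Sum>i\<le>k. fact k / (fact i * fact (2 * k - i)) * s ^ (2 * k - i) * t ^ i)
    = (\<Sum>i\<le>n. c i * s ^ (n - i) * t ^ i)" for s t :: real
  proof -
    have "s ^ r * (\<Sum>i\<le>k. fact k / (fact i * fact (2 * k - i)) * s ^ (2 * k - i) * t ^ i)
      = (\<Sum>i\<le>k. c i * s ^ (n - i) * t ^ i)"
      unfolding sum_distrib_left
    proof (intro sum.cong refl)
      fix i assume "i \<in> {..k}"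
      then have "s ^ (n - i) = s ^ r * s ^ (2 * k - i)" "i \<le> k" 
        by (auto simp: n add.commute simp flip: power_add)
      then show "s ^ r * (fact k / (fact i * fact (2 * k - i)) * s ^ (2 * k - i) * t ^ i) = c i * s ^ (n - i) * t ^ i"
        by (simp add: c_def)
    qed
    also have "\<dots> = (\<Sum>i\<le>n. c i * s ^ (n - i) * t ^ i)"
      by (rule sum.mono_neutral_left) (auto simp: c_def n)
    finally show ?thesis .
  qed
  ultimately have KE: "volume_pair n K E (\<lambda>s t. \<Sum>i\<le>n. c i * s ^ (n - i) * t ^ i)" by simp
  have "(\<Sum>i\<le>n. of_real (c i) * \<omega> ^ i) = (\<Sum>i\<le>k. of_real (c i) * \<omega> ^ i)"
    by (rule sum.mono_neutral_right) (auto simp: c_def n)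
  also have "\<dots> = of_real (fact k / fact (2 * k)) * half_binomial k \<omega>"
    unfolding half_binomial_def sum_distrib_left
  proof (intro sum.cong refl)
    fix i assume "i \<in> {..k}"
    then have "c i = fact k / fact (2 * k) * real (2 * k choose i)"
      by (simp add: c_def binomial_fact)
    then show "of_real (c i) * \<omega> ^ i = of_real (fact k / fact (2 * k)) * (of_nat (2 * k choose i) * \<omega> ^ i)"
      by (simp only: of_real_mult of_real_of_nat_eq mult.assoc)
  qed
  finally have "(\<Sum>i\<le>n. of_real (c i) * \<omega> ^ i) = 0" using assms(1) by simp
  then show ?thesis using volume_pair_root[OF KE] assms by blast
qed

theorem theorem1p4:
  fixes \<gamma> :: complex
  assumes "\<gamma> \<in> {z. 0 \<le> Im z} - complex_of_real ` {0<..}"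
  shows "\<exists>N\<ge>2. \<forall>n\<ge>N. \<gamma> \<in> steiner_roots n"
proof (cases "Im \<gamma> = 0")
  case True
  then have \<gamma>: "\<gamma> = of_real (Re \<gamma>)" by (simp add: complex_eq_iff)
  then have "Re \<gamma> \<le> 0" using assms by force
  then have "\<gamma> \<in> steiner_roots n" if "2 \<le> n" for n
    using nonpos_real_mem_steiner_roots[of "- Re \<gamma>" n] \<gamma> that by simp
  then show ?thesis by blast
next
  case False
  then have Im: "0 < Im \<gamma>" using assms by auto
  \<comment> \<open>The slope bound \<open>\<epsilon>\<close> places \<open>\<omega>\<close> at an
    argument no larger than that of \<open>\<gamma>\<close>; the added 1 keeps the denominator
    positive.\<close>
  define \<epsilon> where "\<epsilon> = Im \<gamma> / (\<bar>Re \<gamma>\<bar> + 1)"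
  have "0 < \<epsilon>" using Im by (simp add: \<epsilon>_def)
  then obtain k \<omega> where \<omega>: "half_binomial k (\<omega>::complex) = 0" "0 < Im \<omega>" "Im \<omega> \<le> \<epsilon> * Re \<omega>"
    by (rule half_binomial_root_small_argument)
  \<comment> \<open>The scaling matches the imaginary parts, and the shift \<open>\<mu>\<close> then
    matches the real parts.\<close>
  define a where "a = Im \<gamma> / Im \<omega>"
  define \<mu> where "\<mu> = Re \<omega> - Re \<gamma> / a"
  have a: "0 < a" using Im \<omega> by (simp add: a_def)
  have "Im \<omega> * (\<bar>Re \<gamma>\<bar> + 1) \<le> Im \<gamma> * Re \<omega>"
    using \<omega>(3) by (simp add: \<epsilon>_def pos_le_divide_eq)
  \<comment> \<open>This comparison of arguments is exactly nonnegativity of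
    \<open>\<mu>\<close>.\<close>
  then have "Im \<omega> * Re \<gamma> \<le> Im \<gamma> * Re \<omega>"
    using \<omega>(2) mult_left_mono[of "Re \<gamma>" "\<bar>Re \<gamma>\<bar> + 1" "Im \<omega>"] by linarith
  then have "0 \<le> \<mu>" using Im \<omega>(2) by (simp add: \<mu>_def a_def field_simps)
  moreover have "\<gamma> = of_real a * (\<omega> - of_real \<mu>)"
    using a \<omega>(2) by (simp add: complex_eq_iff \<mu>_def algebra_simps) (simp add: a_def)
  ultimately have "\<gamma> \<in> steiner_roots n" if "2 * k \<le> n" for n
    using half_binomial_root_mem_steiner_roots[OF \<omega>(1) a] Im that by simp
  then show ?thesis by (intro exI[of _ "2 * k + 2"]) auto
qed

end
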